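(* Let $\lambda=(\lambda_1,\dots,\lambda_n)$ be a Ferrers board, i.e. positive integers $\lambda_1\le\dots\le\lambda_n$, with $\lambda_i\ge i$ for all $i$. Define the multivariate polynomial in $\mathbf{x}=(x_1,\dots,x_{n-1})$ \[ Q^\lambda(\mathbf{x})=\sum_{\sigma\in S_\lambda}\ \prod_{i\in\operatorname{Asc}(\sigma)}x_i . \] Then $Q^\lambda(\mathbf{x})$ is same-phase stable: for every $\mu\in\mathbb{R}_{+}^{n-1}$, the univariate polynomial $t\mapsto Q^\lambda(t\mu)$ is real-rooted.
   Context: A row-complete rook placement on $\lambda$ is a word $\sigma=\sigma_1\cdots\sigma_n$ of distinct positive integers with $1\le\sigma_i\le\lambda_i$ for every $i$; $S_\lambda$ is the set of all such placements. $\operatorname{Asc}(\sigma)=\{i\in[n-1]:\sigma_i<\sigma_{i+1}\}$. $\mathbb{R}_+$ denotes the positive reals. *)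

theory Defs
  imports "HOL-Library.Poly_Mapping" "HOL-Computational_Algebra.Polynomial" Complex_Main
begin

text \<open>Boards and words are lists: \<open>\<lambda>\<^sub>i\<close> is \<open>lam ! (i - 1)\<close>, and \<open>n\<close> is \<open>length lam\<close>.\<close>

definition ferrers_board :: "nat list \<Rightarrow> bool" where
  "ferrers_board lam \<longleftrightarrow> sorted lam \<and> (\<forall>k\<in>set lam. 0 < k)"

definition row_complete_placements :: "nat list \<Rightarrow> nat list set" where
  "row_complete_placements lam =
     {w. length w = length lam \<and> distinct w \<and> (\<forall>i<length lam. 1 \<le> w ! i \<and> w ! i \<le> lam ! i)}"

text \<open>Ascents are the 1-based positions \<open>i \<in> {1..n-1}\<close>, whence the shift in the list indices.\<close>

definition Asc :: "nat list \<Rightarrow> nat set" where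
  "Asc w = {i \<in> {1..<length w}. w ! (i - 1) < w ! i}"

text \<open>Real multivariate polynomials in \<open>x\<^sub>0, x\<^sub>1, \<dots>\<close>: finitely supported maps from exponent
  vectors to coefficients, with the ring structure of \<open>Poly_Mapping\<close>.\<close>

type_synonym real_mpoly = "(nat \<Rightarrow>\<^sub>0 nat) \<Rightarrow>\<^sub>0 real"

definition Var :: "nat \<Rightarrow> real_mpoly" where
  "Var i = Poly_Mapping.single (Poly_Mapping.single i 1) 1"

definition ascent_poly :: "nat list \<Rightarrow> real_mpoly" where
  "ascent_poly lam = (\<Sum>w\<in>row_complete_placements lam. \<Prod>i\<in>Asc w. Var i)"

text \<open>The univariate polynomial \<open>t \<mapsto> P(t\<mu>)\<close>: every \<open>x\<^sub>i\<close> is replaced by \<open>[:0, \<mu>\<^sub>i:] = \<mu>\<^sub>i t\<close>.\<close>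

definition ray_poly :: "real_mpoly \<Rightarrow> (nat \<Rightarrow> real) \<Rightarrow> real poly" where
  "ray_poly P \<mu> = (\<Sum>m\<in>Poly_Mapping.keys P. smult (Poly_Mapping.lookup P m)
     (\<Prod>i\<in>Poly_Mapping.keys m. [:0, \<mu> i:] ^ Poly_Mapping.lookup m i))"

text \<open>The zero polynomial is not real-rooted under this definition.\<close>

definition real_rooted :: "real poly \<Rightarrow> bool" where
  "real_rooted p \<longleftrightarrow> (\<forall>z::complex. poly (map_poly complex_of_real p) z = 0 \<longrightarrow> z \<in> \<real>)"

text \<open>For \<open>P\<close> a polynomial in the variables \<open>x\<^sub>1, \<dots>, x\<^sub>k\<close>; only \<open>\<mu>\<^sub>1, \<dots>, \<mu>\<^sub>k\<close> are then relevant.\<close>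

definition same_phase_stable :: "nat \<Rightarrow> real_mpoly \<Rightarrow> bool" where
  "same_phase_stable k P \<longleftrightarrow>
     (\<forall>\<mu>. (\<forall>i\<in>{1..k}. 0 < \<mu> i) \<longrightarrow> real_rooted (ray_poly P \<mu>))"

end

theory Submission imports Defs begin

text \<open>
  Fix \<open>z\<close> in the upper half plane and put \<open>x\<^sub>i = \<mu>\<^sub>i z\<close>. Sort the placements by the rank of their
  last entry among the values not used before it, and let \<open>f\<^sub>k\<close> be the total weight of those of
  rank \<open>k\<close>. Since the board is increasing, appending a row turns \<open>f\<close> into
  \<open>g\<^sub>k = x\<^sub>n (\<Sum>j\<le>k. f\<^sub>j) + (\<Sum>j>k. f\<^sub>j)\<close>. This map preserves the property that
  \<open>f\<^sub>1, \<dots>, f\<^sub>m, z f\<^sub>1\<close> are nonzero and have weakly increasing arguments that sweep an angle of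
  \<open>arg z < \<pi>\<close>. Such numbers lie in a common open half plane, so that their sum \<open>Q(z\<mu>)\<close> is nonzero.
\<close>

section \<open>Sequences ordered by argument\<close>

text \<open>The oriented area spanned by two plane vectors. For nonzero vectors it is positive
  exactly when \<open>b\<close> lies counterclockwise of \<open>a\<close> by an angle strictly
  between 0 and pi.\<close>

definition cross :: "complex \<Rightarrow> complex \<Rightarrow> real" where
  "cross a b = Im (cnj a * b)"

lemma cross_sum_left: "cross (sum f A) b = (\<Sum>i\<in>A. cross (f i) b)"
  by (simp add: cross_def sum_distrib_right)

lemma cross_sum_right: "cross a (sum f A) = (\<Sum>i\<in>A. cross a (f i))"
  by (simp add: cross_def sum_distrib_left)

lemma cross_zero [simp]: "cross 0 b = 0" "cross a 0 = 0"
  by (simp_all add: cross_def)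

lemma cross_self [simp]: "cross a a = 0"
  by (simp add: cross_def algebra_simps)

lemma cross_mult_both: "cross (w * a) (w * b) = (cmod w)\<^sup>2 * cross a b"
  unfolding cmod_power2 cross_def by (simp add: algebra_simps power2_eq_square)

lemma cross_mult_self: "cross a (w * a) = (cmod a)\<^sup>2 * Im w"
  unfolding cmod_power2 cross_def by (simp add: algebra_simps power2_eq_square)

lemma cross_scale_right: "cross a (of_real c * b) = c * cross a b"
  by (simp add: cross_def algebra_simps)

text \<open>If \<open>0 \<le> Im w\<close>, both expansions are nonnegative as soon as
  \<open>cross s (w * b)\<close> and \<open>cross b s\<close> are.\<close>

lemma cross_add_mult:
  "cross (s + b) (s + w * b) = cross s (w * b) + cross b s + (cmod b)\<^sup>2 * Im w"
  "cross (s + w * b) (w * (s + b)) = (cmod s)\<^sup>2 * Im w + cross s (w * b) + (cmod w)\<^sup>2 * cross b s"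
  unfolding cmod_power2 cross_def by (simp_all add: algebra_simps power2_eq_square)

text \<open>All pairs are compared, not only neighbours, because nonnegativity of
  \<open>cross\<close> is not transitive.\<close>

definition arg_ordered :: "complex \<Rightarrow> nat \<Rightarrow> (nat \<Rightarrow> complex) \<Rightarrow> bool" where
  "arg_ordered z m f \<longleftrightarrow> (\<forall>i\<in>{1..m}. f i \<noteq> 0) \<and>
     (\<forall>i\<in>{1..m}. \<forall>j\<in>{1..m}. i \<le> j \<longrightarrow> 0 \<le> cross (f i) (f j) \<and> 0 \<le> cross (f j) (z * f i))"

lemma arg_orderedD:
  assumes "arg_ordered z m f" "i \<in> {1..m}" "j \<in> {1..m}" "i \<le> j"
  shows "0 \<le> cross (f i) (f j)" "0 \<le> cross (f j) (z * f i)"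
  using assms unfolding arg_ordered_def by blast+

text \<open>Only the direction of \<open>z\<close> matters, so one invariant serves every variable
  \<open>\<mu> i * z\<close>.\<close>

lemma arg_ordered_scale:
  assumes "0 < c"
  shows "arg_ordered (of_real c * z) m f \<longleftrightarrow> arg_ordered z m f"
  using assms
  by (simp add: arg_ordered_def mult.assoc cross_scale_right zero_le_mult_iff)

text \<open>The functional \<open>\<lambda>x. cross v x + cross x (w * v)\<close> is positive on the nonzero vectors of the
  cone spanned by \<open>v\<close> and \<open>w * v\<close>.\<close>

lemma sum_nonzero_of_cone:
  assumes "finite A" "k \<in> A" "h k = v" "v \<noteq> 0" "0 < Im w"
    and "\<And>l. l \<in> A \<Longrightarrow> 0 \<le> cross v (h l)" "\<And>l. l \<in> A \<Longrightarrow> 0 \<le> cross (h l) (w * v)"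
  shows "sum h A \<noteq> 0"
proof
  assume 0: "sum h A = 0"
  have "0 < cross v (h k) + cross (h k) (w * v)"
    using assms(3-5) by (simp add: cross_mult_self)
  also have "\<dots> \<le> (\<Sum>l\<in>A. cross v (h l) + cross (h l) (w * v))"
    using assms by (intro member_le_sum) auto
  also have "\<dots> = cross v (sum h A) + cross (sum h A) (w * v)"
    by (simp add: sum.distrib cross_sum_left cross_sum_right)
  finally show False
    by (simp add: 0)
qed

text \<open>All terms lie in the cone spanned by \<open>f 1\<close> and
  \<open>z * f 1\<close>.\<close>

lemma sum_arg_ordered_nonzero:
  assumes "arg_ordered z m f" "0 < Im z" "1 \<le> m"
  shows "(\<Sum>j\<in>{1..m}. f j) \<noteq> 0"
proof (rule sum_nonzero_of_cone)
  show "f 1 \<noteq> 0"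
    using assms by (auto simp: arg_ordered_def)
qed (use assms in \<open>auto intro: arg_orderedD\<close>)

definition ascent_step :: "complex \<Rightarrow> nat \<Rightarrow> (nat \<Rightarrow> complex) \<Rightarrow> nat \<Rightarrow> complex" where
  "ascent_step w m f k = (\<Sum>j\<in>{1..m}. f j * (if j \<le> k then w else 1))"

text \<open>For \<open>k < m\<close> the summands
  \<open>w * f 1, ..., w * f k, f (k+1), ..., f m\<close> lie in the cone spanned by
  \<open>f (k+1)\<close> and \<open>w * f (k+1)\<close>. Otherwise every summand carries the factor
  \<open>w\<close>.\<close>

lemma ascent_step_nonzero:
  assumes f: "arg_ordered w m f" and w: "0 < Im w" and m: "1 \<le> m"
  shows "ascent_step w m f k \<noteq> 0"
proof (cases "k < m")
  case True
  show ?thesis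
    unfolding ascent_step_def
  proof (rule sum_nonzero_of_cone)
    show "Suc k \<in> {1..m}" "f (Suc k) \<noteq> 0"
      using True f by (auto simp: arg_ordered_def)
    fix l assume l: "l \<in> {1..m}"
    show "0 \<le> cross (f (Suc k)) (f l * (if l \<le> k then w else 1))"
      using l True arg_orderedD[OF f, of l "Suc k"] arg_orderedD[OF f, of "Suc k" l]
      by (auto simp: mult.commute)
    show "0 \<le> cross (f l * (if l \<le> k then w else 1)) (w * f (Suc k))"
      using l True arg_orderedD[OF f, of l "Suc k"] arg_orderedD[OF f, of "Suc k" l]
      by (auto simp: mult.commute[of "f l"] cross_mult_both)
  qed (use w in auto)
next
  case False
  then have "ascent_step w m f k = w * (\<Sum>j\<in>{1..m}. f j)"
    unfolding ascent_step_def sum_distrib_left by (intro sum.cong) auto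
  moreover have "w \<noteq> 0"
    using w by auto
  ultimately show ?thesis
    using sum_arg_ordered_nonzero[OF f w m] by simp
qed

text \<open>The length \<open>m'\<close> is free, since any two indices \<open>i \<le> j\<close> can
  be compared. This lets the number of ranks change from row to row.\<close>

lemma arg_ordered_ascent_step:
  assumes f: "arg_ordered w m f" and w: "0 < Im w" and m: "1 \<le> m"
  shows "arg_ordered w m' (ascent_step w m f)"
proof -
  let ?g = "ascent_step w m f"
  have "0 \<le> cross (?g i) (?g j) \<and> 0 \<le> cross (?g j) (w * ?g i)" if "i \<le> j" for i j
  proof -
    \<comment> \<open>Passing from \<open>i\<close> to \<open>j\<close> multiplies the part \<open>B\<close> by \<open>w\<close> and leaves the part \<open>S\<close> unchanged.\<close>
    define s where "s l = f l * (if l \<le> i then w else if l \<le> j then 0 else 1)" for l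
    define b where "b l = (if i < l \<and> l \<le> j then f l else 0)" for l
    define S where "S = (\<Sum>l\<in>{1..m}. s l)"
    define B where "B = (\<Sum>l\<in>{1..m}. b l)"
    have gi: "?g i = S + B"
      unfolding ascent_step_def S_def B_def sum.distrib[symmetric]
      using that by (intro sum.cong) (auto simp: s_def b_def)
    have gj: "?g j = S + w * B"
      unfolding ascent_step_def S_def B_def sum_distrib_left sum.distrib[symmetric]
      using that by (intro sum.cong) (auto simp: s_def b_def)
    \<comment> \<open>For \<open>l \<le> i\<close> this compares \<open>w * f l\<close> with
      \<open>w * f l'\<close>, where \<open>l < l'\<close>; for \<open>l > j\<close> it compares
      \<open>f l\<close> with \<open>w * f l'\<close>, where \<open>l' < l\<close>.\<close>
    have "0 \<le> cross (s l) (w * b l')" if "l \<in> {1..m}" "l' \<in> {1..m}" for l l'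
      using that \<open>i \<le> j\<close> arg_orderedD[OF f, of l l'] arg_orderedD[OF f, of l' l]
      by (auto simp: s_def b_def mult.commute[of "f l"] cross_mult_both)
    then have 1: "0 \<le> cross S (w * B)"
      unfolding S_def B_def sum_distrib_left cross_sum_left cross_sum_right
      by (intro sum_nonneg)
    have "0 \<le> cross (b l') (s l)" if "l \<in> {1..m}" "l' \<in> {1..m}" for l l'
      using that \<open>i \<le> j\<close> arg_orderedD[OF f, of l l'] arg_orderedD[OF f, of l' l]
      by (auto simp: s_def b_def mult.commute[of "f l"])
    then have 2: "0 \<le> cross B S"
      unfolding S_def B_def cross_sum_left cross_sum_right
      by (intro sum_nonneg)
    show ?thesis
      unfolding gi gj cross_add_mult using 1 2 w by simp
  qed
  then show ?thesis
    using ascent_step_nonzero[OF assms] by (auto simp: arg_ordered_def)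
qed

section \<open>Appending a row\<close>

text \<open>By \<open>butlast\<close> the last entry counts itself, so the ranks of nonempty
  placements start at 1.\<close>

definition last_rank :: "nat list \<Rightarrow> nat" where
  "last_rank w = card ({1..last w} - set (butlast w))"

definition asc_weight :: "(nat \<Rightarrow> 'a::comm_monoid_mult) \<Rightarrow> nat list \<Rightarrow> 'a" where
  "asc_weight x w = (\<Prod>i\<in>Asc w. x i)"

definition rank_sum :: "(nat \<Rightarrow> complex) \<Rightarrow> nat list \<Rightarrow> nat \<Rightarrow> complex" where
  "rank_sum x lam k = (\<Sum>w | w \<in> row_complete_placements lam \<and> last_rank w = k. asc_weight x w)"

section \<open>Placements and ascents on an extended board\<close>

lemma finite_Asc [simp]: "finite (Asc w)"
  by (simp add: Asc_def)

lemma set_row_complete_placement: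
  assumes "w \<in> row_complete_placements lam" "\<And>b. b \<in> set lam \<Longrightarrow> b \<le> a"
  shows "set w \<subseteq> {1..a}"
proof
  fix v assume "v \<in> set w"
  then obtain i where i: "i < length w" "v = w ! i"
    by (metis in_set_conv_nth)
  then have "1 \<le> v" "v \<le> lam ! i" "lam ! i \<in> set lam"
    using assms(1) by (auto simp: row_complete_placements_def)
  then show "v \<in> {1..a}"
    using assms(2) by fastforce
qed

lemma finite_row_complete_placements [simp]: "finite (row_complete_placements lam)"
proof (rule finite_subset)
  show "row_complete_placements lam \<subseteq> {w. set w \<subseteq> {1..Max (set lam)} \<and> length w = length lam}"
    using set_row_complete_placement[of _ lam "Max (set lam)"]
    by (fastforce simp: row_complete_placements_def)
  show "finite {w. set w \<subseteq> {1..Max (set lam)} \<and> length w = length lam}"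
    by (rule finite_lists_length_eq) simp
qed

lemma row_complete_placements_snoc:
  "row_complete_placements (lam @ [a]) =
     {w @ [v] | w v. w \<in> row_complete_placements lam \<and> v \<in> {1..a} - set w}" (is "?L = ?R")
proof (intro equalityI subsetI)
  fix u assume u: "u \<in> ?L"
  then obtain w v where uw: "u = w @ [v]"
    by (cases u rule: rev_cases) (auto simp: row_complete_placements_def)
  have "w \<in> row_complete_placements lam"
    using u unfolding uw row_complete_placements_def
    by (auto simp: nth_append dest: spec less_SucI)
  moreover have "v \<in> {1..a} - set w"
    using u unfolding uw row_complete_placements_def
    by (auto simp: nth_append dest: spec[of _ "length lam"])
  ultimately show "u \<in> ?R"
    using uw by blast
next
  fix u assume "u \<in> ?R"
  then show "u \<in> ?L"
    by (auto simp: row_complete_placements_def nth_append less_Suc_eq)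
qed

text \<open>The only new comparison is that of \<open>last w\<close> with \<open>v\<close>, at the
  1-based position \<open>length w\<close>.\<close>

lemma Asc_snoc:
  assumes "w \<noteq> []"
  shows "Asc (w @ [v]) = Asc w \<union> (if last w < v then {length w} else {})"
  using assms by (cases w rule: rev_cases) (auto simp: Asc_def nth_append less_Suc_eq)

lemma asc_weight_snoc:
  assumes "w \<noteq> []"
  shows "asc_weight x (w @ [v]) = asc_weight x w * (if last w < v then x (length w) else 1)"
proof -
  have "length w \<notin> Asc w"
    by (simp add: Asc_def)
  then show ?thesis
    by (simp add: asc_weight_def Asc_snoc[OF assms] mult.commute)
qed

lemma last_rank_snoc: "last_rank (w @ [v]) = card ({1..v} - set w)"
  by (simp add: last_rank_def)

text \<open>Whether the new position is an ascent depends on the two ranks alone. The rank of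
  \<open>w\<close> is one more than the number of values below \<open>last w\<close> that are still
  free after \<open>w\<close>; if \<open>last w < v\<close>, then \<open>v\<close> itself supplies
  the extra one.\<close>

lemma last_less_iff_last_rank_le:
  assumes "w \<noteq> []" "distinct w" "0 < last w" "v \<notin> set w" "0 < v"
  shows "last w < v \<longleftrightarrow> last_rank w \<le> last_rank (w @ [v])"
proof -
  obtain u l where w: "w = u @ [l]"
    using assms(1) by (cases w rule: rev_cases) auto
  have "{1..l} - set u = insert l ({1..l} - set w)" "l \<notin> {1..l} - set w"
    using assms by (auto simp: w)
  then have "card ({1..l} - set u) = Suc (card ({1..l} - set w))"
    by (metis card_insert_disjoint finite_Diff finite_atLeastAtMost)
  then have rl: "last_rank w = Suc (card ({1..l} - set w))"
    by (simp only: w last_rank_snoc)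
  have l: "last w = l"
    by (simp add: w)
  show ?thesis
  proof (cases "l < v")
    case True
    have "card (insert v ({1..l} - set w)) \<le> card ({1..v} - set w)"
      using assms True by (intro card_mono) auto
    then show ?thesis
      using True by (simp add: l rl last_rank_snoc)
  next
    case False
    have "card ({1..v} - set w) \<le> card ({1..l} - set w)"
      using False by (intro card_mono) auto
    then show ?thesis
      using False by (simp add: l rl last_rank_snoc)
  qed
qed

text \<open>The rank is strictly increasing on \<open>X\<close>, hence injective, and its image in
  \<open>{1..card X}\<close> has full cardinality.\<close>

lemma bij_betw_rank:
  fixes X :: "nat set"
  assumes "finite X"
  shows "bij_betw (\<lambda>v. card {u \<in> X. u \<le> v}) X {1..card X}"
proof (rule bij_betw_imageI)
  show inj: "inj_on (\<lambda>v. card {u \<in> X. u \<le> v}) X"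
  proof (rule linorder_inj_onI)
    fix v v' assume "v < v'" "v \<in> X" "v' \<in> X"
    then have "v' \<in> {u \<in> X. u \<le> v'}" "v' \<notin> {u \<in> X. u \<le> v}"
      and "{u \<in> X. u \<le> v} \<subseteq> {u \<in> X. u \<le> v'}"
      by auto
    then have "{u \<in> X. u \<le> v} \<subset> {u \<in> X. u \<le> v'}"
      by (metis psubsetI)
    then have "card {u \<in> X. u \<le> v} < card {u \<in> X. u \<le> v'}"
      using assms by (simp add: psubset_card_mono)
    then show "card {u \<in> X. u \<le> v} \<noteq> card {u \<in> X. u \<le> v'}"
      by simp
  qed auto
  show "(\<lambda>v. card {u \<in> X. u \<le> v}) ` X = {1..card X}"
  proof (rule card_subset_eq)
    show "(\<lambda>v. card {u \<in> X. u \<le> v}) ` X \<subseteq> {1..card X}"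
    proof (rule image_subsetI)
      fix v assume "v \<in> X"
      then have "{u \<in> X. u \<le> v} \<noteq> {}"
        by auto
      moreover have "card {u \<in> X. u \<le> v} \<le> card X"
        using assms by (intro card_mono) auto
      ultimately show "card {u \<in> X. u \<le> v} \<in> {1..card X}"
        using assms by (simp add: Suc_le_eq card_gt_0_iff)
    qed
    show "card ((\<lambda>v. card {u \<in> X. u \<le> v}) ` X) = card {1..card X}"
      unfolding card_image[OF inj] by simp
  qed simp
qed

text \<open>As \<open>a\<close> bounds the earlier rows, every entry of \<open>w\<close> lies in
  \<open>{1..a}\<close>. Exactly \<open>a - length lam\<close> values remain free, and each is
  determined by its rank among them.\<close>

lemma ex1_last_rank:
  assumes "w \<in> row_complete_placements lam" "\<And>b. b \<in> set lam \<Longrightarrow> b \<le> a"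
    and "k \<in> {1..a - length lam}"
  shows "\<exists>!v. v \<in> {1..a} - set w \<and> last_rank (w @ [v]) = k"
proof -
  let ?X = "{1..a} - set w"
  have "card (set w) = length lam"
    using assms(1) by (auto simp: row_complete_placements_def distinct_card)
  then have "card ?X = a - length lam"
    using set_row_complete_placement[OF assms(1,2)] by (simp add: card_Diff_subset)
  then have "k \<in> {1..card ?X}"
    using assms(3) by simp
  have rank: "last_rank (w @ [v]) = card {u \<in> ?X. u \<le> v}" if "v \<in> ?X" for v
    using that unfolding last_rank_snoc by (intro arg_cong[where f = card]) auto
  have "bij_betw (\<lambda>v. card {u \<in> ?X. u \<le> v}) ?X {1..card ?X}"
    by (rule bij_betw_rank) simp
  moreover have "bij_betw (\<lambda>v. last_rank (w @ [v])) ?X {1..card ?X} \<longleftrightarrow>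
    bij_betw (\<lambda>v. card {u \<in> ?X. u \<le> v}) ?X {1..card ?X}"
    by (rule bij_betw_cong) (rule rank)
  ultimately have bij: "bij_betw (\<lambda>v. last_rank (w @ [v])) ?X {1..card ?X}"
    by blast
  then have "k \<in> (\<lambda>v. last_rank (w @ [v])) ` ?X"
    using \<open>k \<in> {1..card ?X}\<close> by (simp only: bij_betw_imp_surj_on)
  then obtain v where v: "v \<in> ?X" "last_rank (w @ [v]) = k"
    by blast
  show ?thesis
  proof (rule ex1I)
    show "v \<in> ?X \<and> last_rank (w @ [v]) = k"
      using v by blast
    show "u = v" if "u \<in> ?X \<and> last_rank (w @ [u]) = k" for u
      using inj_onD[OF bij_betw_imp_inj_on[OF bij], of u v] that v by simp
  qed
qed

lemma last_rank_range:
  assumes "w \<in> row_complete_placements (lam @ [a])" "\<And>b. b \<in> set lam \<Longrightarrow> b \<le> a"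
  shows "last_rank w \<in> {1..a - length lam}"
proof -
  obtain u v where w: "w = u @ [v]" and u: "u \<in> row_complete_placements lam"
    and v: "v \<in> {1..a} - set u"
    using assms(1) by (auto simp: row_complete_placements_snoc)
  have "card (set u) = length lam"
    using u by (auto simp: row_complete_placements_def distinct_card)
  then have "card ({1..a} - set u) = a - length lam"
    using set_row_complete_placement[OF u assms(2)] by (simp add: card_Diff_subset)
  moreover have "card ({1..v} - set u) \<le> card ({1..a} - set u)"
    using v by (intro card_mono) auto
  moreover have "0 < card ({1..v} - set u)"
    using v by (auto simp: card_gt_0_iff)
  ultimately show ?thesis
    by (simp add: w last_rank_snoc)
qed

text \<open>Each placement on \<open>lam\<close> has exactly one extension of rank \<open>k\<close>,
  and its new factor depends only on the old rank. The number of old ranks is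
  \<open>last lam - (length lam - 1)\<close>, written here with \<open>Suc\<close>.\<close>

lemma rank_sum_snoc:
  assumes ne: "lam \<noteq> []" and srt: "sorted (lam @ [a])"
    and k: "k \<in> {1..a - length lam}"
  shows "rank_sum x (lam @ [a]) k =
    ascent_step (x (length lam)) (Suc (last lam) - length lam) (rank_sum x lam) k"
proof -
  let ?R = "row_complete_placements lam" and ?m = "Suc (last lam) - length lam"
  let ?c = "\<lambda>r. if r \<le> k then x (length lam) else 1"
  have le: "b \<le> a" if "b \<in> set lam" for b
    using srt that by (auto simp: sorted_append)
  have "\<forall>w\<in>?R. \<exists>v. v \<in> {1..a} - set w \<and> last_rank (w @ [v]) = k"
    using ex1_last_rank[OF _ le k] by blast
  then obtain V where V: "\<And>w. w \<in> ?R \<Longrightarrow> V w \<in> {1..a} - set w \<and> last_rank (w @ [V w]) = k"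
    by (metis bchoice)
  have uniq: "v = V w" if "w \<in> ?R" "v \<in> {1..a} - set w" "last_rank (w @ [v]) = k" for w v
    using ex1_last_rank[OF that(1) le k] V[OF that(1)] that by blast
  have eq: "{w. w \<in> row_complete_placements (lam @ [a]) \<and> last_rank w = k} = (\<lambda>w. w @ [V w]) ` ?R"
    using V uniq unfolding row_complete_placements_snoc by blast
  have wt: "asc_weight x (w @ [V w]) = asc_weight x w * ?c (last_rank w)" if w: "w \<in> ?R" for w
  proof -
    have len: "length w = length lam" "distinct w" and "set w \<subseteq> {1..a}"
      using w set_row_complete_placement[OF w le] by (auto simp: row_complete_placements_def)
    moreover have "w \<noteq> []"
      using len ne by auto
    ultimately have "0 < last w"
      using last_in_set[of w] by (force simp del: last_in_set)
    then show ?thesis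
      using last_less_iff_last_rank_le[of w "V w"] \<open>w \<noteq> []\<close> len V[OF w]
      by (simp add: asc_weight_snoc)
  qed
  have rng: "last_rank w \<in> {1..?m}" if "w \<in> ?R" for w
  proof -
    obtain l b where lam: "lam = l @ [b]"
      using ne by (cases lam rule: rev_cases) auto
    show ?thesis
      using last_rank_range[of w l b] that srt by (auto simp: lam sorted_append)
  qed
  have "rank_sum x (lam @ [a]) k = (\<Sum>w\<in>?R. asc_weight x w * ?c (last_rank w))"
    unfolding rank_sum_def eq
    by (subst sum.reindex) (auto simp: inj_on_def wt intro: sum.cong)
  \<comment> \<open>The placements on \<open>lam\<close> are grouped by their own rank
    \<open>j\<close>.\<close>
  also have "\<dots> = (\<Sum>j\<in>{1..?m}. \<Sum>w | w \<in> ?R \<and> last_rank w = j. asc_weight x w * ?c (last_rank w))"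
    using rng by (intro sum.group[symmetric]) auto
  also have "\<dots> = ascent_step (x (length lam)) ?m (rank_sum x lam) k"
    unfolding ascent_step_def rank_sum_def sum_distrib_right
    by (intro sum.cong) auto
  finally show ?thesis .
qed

lemma sum_rank_sum:
  assumes "lam \<noteq> []" "sorted lam"
  shows "(\<Sum>k\<in>{1..Suc (last lam) - length lam}. rank_sum x lam k) =
    (\<Sum>w\<in>row_complete_placements lam. asc_weight x w)"
proof -
  obtain l a where lam: "lam = l @ [a]"
    using assms(1) by (cases lam rule: rev_cases) auto
  have "last_rank w \<in> {1..Suc (last lam) - length lam}" if "w \<in> row_complete_placements lam" for w
    using last_rank_range[of w l a] that assms(2) by (auto simp: lam sorted_append)
  then show ?thesis
    unfolding rank_sum_def by (intro sum.group) auto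
qed

lemma rank_sum_singleton:
  assumes "k \<in> {1..a}"
  shows "rank_sum x [a] k = 1"
proof -
  have "row_complete_placements [] = {[]}"
    by (auto simp: row_complete_placements_def)
  then have "row_complete_placements [a] = (\<lambda>v. [v]) ` {1..a}"
    using row_complete_placements_snoc[of "[]" a] by auto
  then have "{w. w \<in> row_complete_placements [a] \<and> last_rank w = k} = {[k]}"
    using assms by (auto simp: last_rank_def)
  moreover have "asc_weight x [k] = 1"
    by (simp add: asc_weight_def Asc_def)
  ultimately show ?thesis
    by (simp add: rank_sum_def)
qed

text \<open>With one row all rank sums are 1; each further row acts by \<open>ascent_step\<close>,
  which preserves the ordering.\<close>

lemma arg_ordered_rank_sum:
  assumes "lam \<noteq> []" "sorted lam" "\<And>i. i < length lam \<Longrightarrow> i < lam ! i" "0 < Im z"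
    and "\<And>i. i \<in> {1..<length lam} \<Longrightarrow> 0 < \<mu> i"
  shows "arg_ordered z (Suc (last lam) - length lam) (rank_sum (\<lambda>i. of_real (\<mu> i) * z) lam)"
  using assms
proof (induction lam rule: rev_induct)
  case Nil
  then show ?case by simp
next
  case (snoc a lam)
  let ?x = "\<lambda>i. of_real (\<mu> i) * z"
  show ?case
  proof (cases "lam = []")
    case True
    then show ?thesis
      using \<open>0 < Im z\<close> by (simp add: arg_ordered_def rank_sum_singleton cross_def)
  next
    case False
    let ?n = "length lam" and ?m = "Suc (last lam) - length lam"
    have mu: "0 < \<mu> ?n"
      using snoc.prems(5) False by (simp add: Suc_le_eq)
    have ordered: "arg_ordered z ?m (rank_sum ?x lam)"
    proof (rule snoc.IH[OF False])
      show "i < lam ! i" if "i < ?n" for i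
        using snoc.prems(3)[of i] that by (simp add: nth_append)
    qed (use snoc.prems in \<open>auto simp: sorted_append\<close>)
    \<comment> \<open>The lower bound on the last row of \<open>lam\<close> gives
      \<open>1 \<le> ?m\<close>, so there is at least one rank.\<close>
    have "?n \<le> last lam"
      using snoc.prems(3)[of "?n - 1"] False by (simp add: nth_append last_conv_nth less_Suc_eq)
    then have "arg_ordered (?x ?n) (a - ?n) (ascent_step (?x ?n) ?m (rank_sum ?x lam))"
      using ordered mu \<open>0 < Im z\<close>
      by (intro arg_ordered_ascent_step) (auto simp: arg_ordered_scale)
    then have "arg_ordered z (a - ?n) (ascent_step (?x ?n) ?m (rank_sum ?x lam))"
      using arg_ordered_scale[OF mu] by blast
    \<comment> \<open>\<open>rank_sum_snoc\<close> covers only ranks in \<open>{1..a - ?n}\<close>,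
      which are all that \<open>arg_ordered\<close> inspects.\<close>
    then have "arg_ordered z (a - ?n) (rank_sum ?x (lam @ [a]))"
      using rank_sum_snoc[OF False snoc.prems(2), of _ ?x] unfolding arg_ordered_def by simp
    then show ?thesis
      by simp
  qed
qed

lemma sum_asc_weight_nonzero:
  assumes "sorted lam" "\<And>i. i < length lam \<Longrightarrow> i < lam ! i" "0 < Im z"
    and "\<And>i. i \<in> {1..<length lam} \<Longrightarrow> 0 < \<mu> i"
  shows "(\<Sum>w\<in>row_complete_placements lam. asc_weight (\<lambda>i. of_real (\<mu> i) * z) w) \<noteq> 0"
proof (cases "lam = []")
  case True
  then have "row_complete_placements lam = {[]}"
    by (auto simp: row_complete_placements_def)
  then show ?thesis
    by (simp add: asc_weight_def Asc_def)
next
  case False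
  have "length lam \<le> last lam"
    using assms(2)[of "length lam - 1"] False by (simp add: last_conv_nth)
  then have "1 \<le> Suc (last lam) - length lam"
    by simp
  from sum_arg_ordered_nonzero[OF arg_ordered_rank_sum[where \<mu> = \<mu>, OF False assms] assms(3) this]
  show ?thesis
    by (simp only: sum_rank_sum[OF False assms(1)] not_False_eq_True)
qed

section \<open>Evaluation along a ray\<close>

text \<open>Coefficients outside the support vanish. A common index set is needed for sums, where
  cancellation may shrink the support.\<close>

lemma ray_poly_superset:
  assumes "finite K" "Poly_Mapping.keys P \<subseteq> K"
  shows "ray_poly P \<mu> = (\<Sum>m\<in>K. smult (Poly_Mapping.lookup P m)
     (\<Prod>i\<in>Poly_Mapping.keys m. [:0, \<mu> i:] ^ Poly_Mapping.lookup m i))"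
  unfolding ray_poly_def using assms
  by (intro sum.mono_neutral_left) (auto simp: in_keys_iff)

lemma ray_poly_add: "ray_poly (P + Q) \<mu> = ray_poly P \<mu> + ray_poly Q \<mu>"
proof -
  let ?K = "Poly_Mapping.keys P \<union> Poly_Mapping.keys Q"
  have "Poly_Mapping.keys (P + Q) \<subseteq> ?K"
    by (rule Poly_Mapping.keys_add)
  then show ?thesis
    by (simp add: ray_poly_superset[of ?K] lookup_add smult_add_left sum.distrib)
qed

lemma ray_poly_sum: "ray_poly (\<Sum>a\<in>A. P a) \<mu> = (\<Sum>a\<in>A. ray_poly (P a) \<mu>)"
proof (induction A rule: infinite_finite_induct)
qed (simp_all add: ray_poly_add ray_poly_superset[of "{}"])

lemma prod_Var:
  assumes "finite A"
  shows "(\<Prod>i\<in>A. Var i) = Poly_Mapping.single (\<Sum>i\<in>A. Poly_Mapping.single i 1) 1"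
  using assms by (induction A) (auto simp: Var_def mult_single)

text \<open>A product of distinct variables is a single monomial whose exponents are 0 or 1.\<close>

lemma ray_poly_prod_Var:
  assumes "finite A"
  shows "ray_poly (\<Prod>i\<in>A. Var i) \<mu> = (\<Prod>i\<in>A. [:0, \<mu> i:])"
proof -
  let ?m = "\<Sum>i\<in>A. Poly_Mapping.single i (1::nat)"
  have lookup: "Poly_Mapping.lookup ?m i = (if i \<in> A then 1 else 0)" for i
    using assms by (simp add: lookup_sum lookup_single when_def)
  then have "Poly_Mapping.keys ?m = A"
    by (auto simp: in_keys_iff split: if_splits)
  then show ?thesis
    using lookup by (simp add: prod_Var[OF assms] ray_poly_def)
qed

section \<open>Evaluation at complex numbers\<close>

lemma map_poly_of_real_sum:
  "map_poly of_real (\<Sum>a\<in>A. p a) = (\<Sum>a\<in>A. map_poly of_real (p a))"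
  by (intro poly_eqI) (simp add: coeff_map_poly coeff_sum)

lemma map_poly_of_real_mult:
  "(map_poly of_real (p * q) :: 'a::{comm_ring_1, real_algebra_1} poly) =
    map_poly of_real p * map_poly of_real q"
  by (intro poly_eqI) (simp add: coeff_map_poly coeff_mult)

lemma map_poly_of_real_prod:
  "(map_poly of_real (\<Prod>a\<in>A. p a) :: 'a::{comm_ring_1, real_algebra_1} poly) =
    (\<Prod>a\<in>A. map_poly of_real (p a))"
  by (induction A rule: infinite_finite_induct) (simp_all add: map_poly_of_real_mult)

lemma poly_ray_ascent_poly:
  "poly (map_poly complex_of_real (ray_poly (ascent_poly lam) \<mu>)) z =
    (\<Sum>w\<in>row_complete_placements lam. asc_weight (\<lambda>i. of_real (\<mu> i) * z) w)"
  by (simp add: ascent_poly_def ray_poly_sum ray_poly_prod_Var asc_weight_def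
      map_poly_of_real_sum map_poly_of_real_prod map_poly_pCons poly_sum poly_prod mult.commute)

theorem theorem2p7:
  fixes lam :: "nat list"
  assumes "ferrers_board lam"
    and "\<And>i. i \<in> {1..length lam} \<Longrightarrow> i \<le> lam ! (i - 1)"
  shows "same_phase_stable (length lam - 1) (ascent_poly lam)"
  unfolding same_phase_stable_def real_rooted_def
proof (intro allI impI)
  fix \<mu> :: "nat \<Rightarrow> real" and z :: complex
  assume mu: "\<forall>i\<in>{1..length lam - 1}. 0 < \<mu> i"
    and root: "poly (map_poly complex_of_real (ray_poly (ascent_poly lam) \<mu>)) z = 0"
  let ?Q = "\<lambda>z. \<Sum>w\<in>row_complete_placements lam. asc_weight (\<lambda>i. of_real (\<mu> i) * z) w"
  have nonzero: "?Q y \<noteq> 0" if "0 < Im y" for y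
  proof (rule sum_asc_weight_nonzero)
    show "sorted lam"
      using assms(1) by (simp add: ferrers_board_def)
    show "i < lam ! i" if "i < length lam" for i
      using assms(2)[of "Suc i"] that by simp
  qed (use mu that in auto)
  have "?Q z = 0"
    using root by (simp only: poly_ray_ascent_poly)
  \<comment> \<open>The coefficients are real, so a root in the lower half plane would give one in
    the upper half plane.\<close>
  moreover have "?Q (cnj z) = cnj (?Q z)"
    by (simp add: asc_weight_def)
  ultimately have "Im z = 0"
    using nonzero[of z] nonzero[of "cnj z"] by fastforce
  then show "z \<in> \<real>"
    by (simp add: complex_is_Real_iff)
qed

end
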